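(* Let $n>2$ be even, let $m=n/2$ and $a=0$, and let $f:[0,1)^n\to\{0,1\}$ be $f(\mathbf x)=1$ if $\sum_{i\in\mathcal H^+}x_i-\sum_{i\in\mathcal H^-}x_i\ge0$ and $f(\mathbf x)=0$ otherwise, where $\mathcal H^+,\mathcal H^-$ partition $\{1,\dots,n\}$ and $|\mathcal H^+|=|\mathcal H^-|=n/2$. Let $\mathbf X$ be uniformly distributed on $[0,1)^n$. Then every rectangle contained in $f^{-1}(0)$ has probability at most $2^{-n}$, and consequently every zero-error rectangular partition, with cell probabilities $p=(p_1,p_2,\dots)$, has entropy $H(p)=\sum_ip_i\log_2(1/p_i)\ge n$ bits.
   Context: A rectangle means a (combinatorial) rectangle, i.e. a Cartesian product $S_1\times\cdots\times S_n$ where each $S_i\subseteq[0,1)$ is a countable union of intervals. A zero-error rectangular partition is a countable partition of $[0,1)^n$ (up to a set of Lebesgue measure zero) into rectangles each of which is contained either in $f^{-1}(0)$ or in $f^{-1}(1)$. Such partitions arise from zero-error interactive protocols computing $f$ when $X_i$ is known only at node $i$. *)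

theory Defs
  imports "HOL-Probability.Probability"
begin

text \<open>The coordinates \<open>1, \<dots>, n\<close> are rendered by a finite index type \<open>'n\<close> with \<open>n = CARD('n)\<close>.\<close>

definition unit_cube :: "(real ^ 'n) set" where
  "unit_cube = {x. \<forall>i. x $ i \<in> {0..<1}}"

text \<open>Intervals may be open, closed, half-open, degenerate or empty.\<close>

definition rectangle :: "(real ^ 'n) set \<Rightarrow> bool" where
  "rectangle R \<longleftrightarrow>
     (\<exists>S :: 'n \<Rightarrow> real set.
        (\<forall>i. S i \<subseteq> {0..<1} \<and> (countable union_of is_interval) (S i)) \<and>
        R = {x. \<forall>i. x $ i \<in> S i})"

definition halfspace_fun :: "'n set \<Rightarrow> 'n set \<Rightarrow> real \<Rightarrow> real ^ 'n \<Rightarrow> nat" where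
  "halfspace_fun Hp Hm a x = (if (\<Sum>i\<in>Hp. x $ i) - (\<Sum>i\<in>Hm. x $ i) \<ge> a then 1 else 0)"

text \<open>The preimage \<open>f\<^sup>-\<^sup>1(b)\<close> of \<open>f\<close> regarded as a function on \<open>[0,1)\<^sup>n\<close>.\<close>

definition level_set :: "(real ^ 'n \<Rightarrow> nat) \<Rightarrow> nat \<Rightarrow> (real ^ 'n) set" where
  "level_set f b = {x \<in> unit_cube. f x = b}"

text \<open>
  A partition up to a null set: outside some Lebesgue null set, every point of the cube lies in
  exactly one cell. Overlaps of measure zero between cells are thus allowed as well.
\<close>

definition zero_error_partition ::
    "(real ^ 'n \<Rightarrow> nat) \<Rightarrow> (real ^ 'n) set set \<Rightarrow> bool" where
  "zero_error_partition f P \<longleftrightarrow>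
     countable P \<and>
     (\<forall>R\<in>P. rectangle R \<and> (R \<subseteq> level_set f 0 \<or> R \<subseteq> level_set f 1)) \<and>
     (AE x in lborel. x \<in> unit_cube \<longrightarrow> (\<exists>!R. R \<in> P \<and> x \<in> R))"

text \<open>
  The sum is taken in the extended nonnegative reals, since the entropy of a countably infinite
  family may be infinite. For \<open>p i \<in> [0,1]\<close> no term is truncated by the coercion, and a term with
  \<open>p i = 0\<close> is \<open>0\<close>, as usual.
\<close>

definition shannon_entropy :: "'i set \<Rightarrow> ('i \<Rightarrow> real) \<Rightarrow> ennreal" where
  "shannon_entropy I p = (\<Sum>\<^sub>\<infinity>i\<in>I. ennreal (p i * log 2 (1 / p i)))"

end

(*
  Let R = S_1 x ... x S_n be a nonempty rectangle on which sum_{Hp} x_i \<le> sum_{Hm} x_i. Since the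
  coordinates vary independently, sum_{Hp} sup S_i \<le> sum_{Hm} inf S_i. Hence R lies in a box with
  sides [0, sup S_i] (i in Hp) and [inf S_i, 1] (i in Hm) whose lengths add up to at most n/2, and
  AM-GM bounds its volume by 2^-n. Exchanging Hp and Hm gives the same bound for the cells contained
  in f^-1(1), so all cells have log_2(1/p) \<ge> n, and the entropy is at least n times the total mass.
*)

theory Submission
  imports Defs
begin

section \<open>General inequalities: AM-GM in power form and countable subadditivity\<close>

lemma prod_le_mean_power:
  fixes x :: "'a \<Rightarrow> real"
  assumes "finite S" "S \<noteq> {}" "\<And>i. i \<in> S \<Longrightarrow> x i \<ge> 0"
  shows "(\<Prod>i\<in>S. x i) \<le> ((\<Sum>i\<in>S. x i) / card S) ^ card S"
proof -
  let ?n = "card S" and ?p = "\<Prod>i\<in>S. x i"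
  have n: "?n > 0" using assms by (simp add: card_gt_0_iff)
  have p: "?p \<ge> 0" using assms by (simp add: prod_nonneg)
  have "?p = (?p powr (1 / ?n)) ^ ?n"
  \<comment> \<open>\<open>powr_realpow\<close> requires a positive base, so a vanishing product is
    treated apart; there both sides are 0 because \<open>?n > 0\<close>.\<close>
  proof (cases "?p = 0")
    case True
    then show ?thesis using n by simp
  next
    case False
    then show ?thesis using p n by (simp add: powr_realpow [symmetric] powr_powr)
  qed
  also have "\<dots> \<le> ((\<Sum>i\<in>S. x i / ?n)) ^ ?n"
    using arith_geom_mean [of S x] assms by (intro power_mono) auto
  finally show ?thesis by (simp add: sum_divide_distrib)
qed

text \<open>Finite unions along an enumeration of \<open>P\<close> increase to
  \<Union>\<open>P\<close>. Each is bounded by a finite sum, and \<open>infsum\<close> over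
  \<open>ennreal\<close> is the supremum of the finite sums.\<close>

lemma emeasure_Union_le_infsum:
  assumes "countable P" "P \<subseteq> sets M"
  shows "emeasure M (\<Union>P) \<le> (\<Sum>\<^sub>\<infinity>R\<in>P. emeasure M R)"
proof (cases "P = {}")
  case True
  then show ?thesis by simp
next
  case False
  \<comment> \<open>\<open>from_nat_into P\<close> repeats members when \<open>P\<close> is finite.
    Working with its image as a set counts every member once in the sums below.\<close>
  define B where "B n = (\<Union>(from_nat_into P ` {..<n}))" for n :: nat
  have sub: "from_nat_into P ` {..<n} \<subseteq> P" for n :: nat
    using False from_nat_into by blast
  have "range B \<subseteq> sets M"
    using sub assms(2) unfolding B_def by (blast intro: sets.finite_Union finite_imageI)
  moreover have "incseq B"
    unfolding B_def incseq_def by fastforce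
  ultimately have "(SUP n. emeasure M (B n)) = emeasure M (\<Union>n. B n)"
    by (rule SUP_emeasure_incseq)
  moreover have "(\<Union>n. B n) = \<Union>P"
  proof -
    have "(\<Union>n. B n) = \<Union>(range (from_nat_into P))"
      unfolding B_def by blast
    then show ?thesis using range_from_nat_into [OF False assms(1)] by simp
  qed
  moreover have "emeasure M (B n) \<le> (\<Sum>\<^sub>\<infinity>R\<in>P. emeasure M R)" for n
  proof -
    let ?F = "from_nat_into P ` {..<n}"
    have "emeasure M (B n) \<le> (\<Sum>R\<in>?F. emeasure M R)"
      unfolding B_def using emeasure_subadditive_finite [of ?F "\<lambda>R. R" M] sub assms(2) by auto
    also have "\<dots> \<le> (\<Sum>\<^sub>\<infinity>R\<in>P. emeasure M R)"
      using sub by (subst nonneg_infsum_complete) (auto intro!: SUP_upper)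
    finally show ?thesis .
  qed
  ultimately show ?thesis
    by (metis SUP_least)
qed

section \<open>Measurability and volume of rectangles, boxes and the cube\<close>

lemma rectangle_measurable:
  fixes R :: "(real ^ 'n::finite) set"
  assumes "rectangle R"
  shows "R \<in> sets borel"
proof -
  obtain S where S: "\<forall>i. S i \<subseteq> {0..<1} \<and> (countable union_of is_interval) (S i)"
      "R = {x. \<forall>i. x $ i \<in> S i}"
    using assms unfolding rectangle_def by (elim exE conjE) (rule that)
  have [measurable]: "S i \<in> sets borel" for i
  proof -
    obtain U where "countable U" "U \<subseteq> Collect is_interval" "\<Union>U = S i"
      using S(1) unfolding union_of_def by meson
    then show ?thesis
      using real_interval_borel_measurable by (metis mem_Collect_eq sets.countable_Union subset_eq)
  qed
  have "R = (\<Inter>i. (\<lambda>x. x $ i) -` S i)"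
    using S(2) by auto
  moreover have "(\<lambda>x::real ^ 'n. x $ i) -` S i \<in> sets borel" for i
    using measurable_sets [of "\<lambda>x::real ^ 'n. x $ i" borel borel "S i"]
    by (simp add: borel_measurable_continuous_onI continuous_intros)
  ultimately show ?thesis by (auto intro: sets.finite_INT)
qed

lemma rectangle_subset_unit_cube: "rectangle R \<Longrightarrow> R \<subseteq> unit_cube"
  unfolding rectangle_def unit_cube_def by blast

lemma emeasure_box_cart:
  fixes l u :: "real ^ 'n::finite"
  assumes "\<And>i. l $ i \<le> u $ i"
  shows "emeasure lborel (cbox l u) = ennreal (\<Prod>i\<in>UNIV. u $ i - l $ i)"
proof -
  have "cbox l u \<noteq> {}"
    using assms by (auto simp: mem_box_cart set_eq_iff)
  then show ?thesis
    by (metis content_cbox_cart emeasure_eq_ennreal_measure emeasure_lborel_cbox_finite less_irrefl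
        infinity_ennreal_def)
qed

lemma unit_cube_measurable: "(unit_cube :: (real ^ 'n::finite) set) \<in> sets borel"
proof -
  have "is_interval {0..<1::real}"
    by (auto simp: is_interval_1)
  then have "(countable union_of is_interval) {0..<1::real}"
    by (intro union_of_inc) auto
  then have "rectangle (unit_cube :: (real ^ 'n) set)"
    unfolding rectangle_def unit_cube_def by (intro exI [of _ "\<lambda>_. {0..<1}"]) auto
  then show ?thesis by (rule rectangle_measurable)
qed

text \<open>The half-open cube is squeezed between the open and the closed unit box, whose volumes
  agree.\<close>

lemma emeasure_unit_cube: "emeasure lborel (unit_cube :: (real ^ 'n::finite) set) = 1"
proof (rule antisym)
  have c: "emeasure lborel (cbox 0 1 :: (real ^ 'n) set) = 1"
    by (subst emeasure_box_cart) auto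
  have "unit_cube \<subseteq> (cbox 0 1 :: (real ^ 'n) set)"
    unfolding unit_cube_def by (auto simp: mem_box_cart less_imp_le)
  then show "emeasure lborel (unit_cube :: (real ^ 'n) set) \<le> 1"
    using emeasure_mono [of unit_cube "cbox 0 1 :: (real ^ 'n) set" lborel] c by simp
  have "emeasure lborel (box 0 1 :: (real ^ 'n) set) = emeasure lborel (cbox 0 1 :: (real ^ 'n) set)"
    by (simp add: emeasure_lborel_box_eq emeasure_lborel_cbox_eq)
  moreover have "box 0 1 \<subseteq> (unit_cube :: (real ^ 'n) set)"
    unfolding unit_cube_def by (auto simp: mem_box_cart less_imp_le)
  ultimately show "1 \<le> emeasure lborel (unit_cube :: (real ^ 'n) set)"
    using emeasure_mono [of "box 0 1 :: (real ^ 'n) set" unit_cube lborel] c unit_cube_measurable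
    by simp
qed

text \<open>\<open>A\<close> and \<open>B\<close> are kept abstract and the inequality weak so that
  both level sets are covered: \<open>A = Hp\<close>, \<open>B = Hm\<close> serves value 0, and the
  exchanged choice serves value 1.\<close>

lemma emeasure_rectangle_le:
  fixes R :: "(real ^ 'n::finite) set" and A B :: "'n set"
  assumes R: "rectangle R"
    and AB: "A \<union> B = UNIV" "A \<inter> B = {}" "card A = card B"
    and le: "\<And>x. x \<in> R \<Longrightarrow> (\<Sum>i\<in>A. x $ i) \<le> (\<Sum>i\<in>B. x $ i)"
  shows "emeasure lborel R \<le> ennreal (1 / 2 ^ CARD('n))"
proof (cases "R = {}")
  case True
  then show ?thesis by simp
next
  case False
  obtain S where S: "\<forall>i. S i \<subseteq> {0..<1} \<and> (countable union_of is_interval) (S i)"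
      and RS: "R = {x. \<forall>i. x $ i \<in> S i}"
    using R unfolding rectangle_def by (elim exE conjE) (rule that)
  then have S01: "S i \<subseteq> {0..<1}" for i
    by simp
  \<comment> \<open>A nonempty product has nonempty factors, so \<open>Sup (S i)\<close> and
    \<open>Inf (S i)\<close> are genuine bounds rather than unspecified values.\<close>
  have S_ne: "S i \<noteq> {}" for i
    using False RS by auto
  have bdd: "bdd_above (S i)" "bdd_below (S i)" for i
    using S01 [of i] by (auto intro: bdd_above_mono bdd_below_mono)
  have Sup01: "0 \<le> Sup (S i)" "Sup (S i) \<le> 1" "0 \<le> Inf (S i)" "Inf (S i) \<le> 1" for i
  proof -
    obtain s where s: "s \<in> S i" using S_ne by blast
    have "0 \<le> s" "s \<le> 1" using s S01 [of i] by auto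
    then show "0 \<le> Sup (S i)" "Inf (S i) \<le> 1"
      using cSup_upper [OF s bdd(1)] cInf_lower [OF s bdd(2)] by auto
    show "Sup (S i) \<le> 1" "0 \<le> Inf (S i)"
      using S01 [of i] by (auto intro!: cSup_least cInf_greatest S_ne)
  qed
  have fin: "finite A" "finite B" by simp_all
  have Sup_le_Inf: "(\<Sum>i\<in>A. Sup (S i)) \<le> (\<Sum>i\<in>B. Inf (S i))"
  proof (rule field_le_epsilon)
    fix e :: real assume "e > 0"
    \<comment> \<open>Each coordinate may miss its supremum or infimum by \<open>d\<close>; over all
      \<open>card A + card B = CARD('n)\<close> coordinates the loss is \<open>e\<close>.\<close>
    define d where "d = e / CARD('n)"
    have d: "d > 0" using \<open>e > 0\<close> by (simp add: d_def)
    have "\<exists>s \<in> S i. (i \<in> A \<longrightarrow> Sup (S i) - d \<le> s) \<and> (i \<in> B \<longrightarrow> s \<le> Inf (S i) + d)" for i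
    proof (cases "i \<in> A")
      case True
      then have "i \<notin> B" using AB(2) by auto
      moreover have "\<exists>s \<in> S i. Sup (S i) - d < s"
        using d by (intro less_cSupD S_ne) simp
      ultimately show ?thesis by (meson less_imp_le)
    next
      case False
      moreover have "\<exists>s \<in> S i. s < Inf (S i) + d"
        using d by (intro cInf_lessD S_ne) simp
      ultimately show ?thesis by (meson less_imp_le)
    qed
    then obtain s where s: "\<And>i. s i \<in> S i" "\<And>i. i \<in> A \<Longrightarrow> Sup (S i) - d \<le> s i"
        "\<And>i. i \<in> B \<Longrightarrow> s i \<le> Inf (S i) + d"
      by metis
    \<comment> \<open>The product structure enters here: near-extremal values chosen separately in
      each factor form a single point of \<open>R\<close>, to which \<open>le\<close>
      applies.\<close>
    have "(\<chi> i. s i) \<in> R" using RS s(1) by simp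
    then have "(\<Sum>i\<in>A. s i) \<le> (\<Sum>i\<in>B. s i)" using le by fastforce
    moreover have "(\<Sum>i\<in>A. Sup (S i) - d) \<le> (\<Sum>i\<in>A. s i)"
      using s(2) by (rule sum_mono)
    moreover have "(\<Sum>i\<in>B. s i) \<le> (\<Sum>i\<in>B. Inf (S i) + d)"
      using s(3) by (rule sum_mono)
    ultimately have "(\<Sum>i\<in>A. Sup (S i)) \<le> (\<Sum>i\<in>B. Inf (S i)) + (real (card A) * d + real (card B) * d)"
      by (simp add: sum.distrib sum_subtractf)
    also have "real (card A) * d + real (card B) * d = e"
    proof -
      have "card A + card B = CARD('n)"
        using card_Un_disjoint [OF fin AB(2)] AB(1) by simp
      then have "real (card A) + real (card B) = real CARD('n)"
        by (metis of_nat_add)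
      then show ?thesis unfolding d_def by (simp add: field_simps flip: distrib_left)
    qed
    finally show "(\<Sum>i\<in>A. Sup (S i)) \<le> (\<Sum>i\<in>B. Inf (S i)) + e" .
  qed
  \<comment> \<open>Only the ends controlled by \<open>Sup_le_Inf\<close> come from
    \<open>S\<close>; the remaining ends are pushed out to 0 and 1.\<close>
  define l u :: "real ^ 'n" where
    "l = (\<chi> i. if i \<in> A then 0 else Inf (S i))" and "u = (\<chi> i. if i \<in> A then Sup (S i) else 1)"
  have lu: "l $ i \<le> u $ i" for i
    using Sup01 by (simp add: l_def u_def)
  have "R \<subseteq> cbox l u"
  proof
    fix x assume "x \<in> R"
    then have x: "x $ i \<in> S i" for i using RS by simp
    have "l $ i \<le> x $ i \<and> x $ i \<le> u $ i" for i
      using x [of i] S01 [of i] cSup_upper [OF x bdd(1), of i] cInf_lower [OF x bdd(2), of i]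
      by (auto simp: l_def u_def)
    then show "x \<in> cbox l u" by (simp add: mem_box_cart)
  qed
  then have "emeasure lborel R \<le> emeasure lborel (cbox l u)"
    by (rule emeasure_mono) simp
  also have "\<dots> = ennreal (\<Prod>i\<in>UNIV. u $ i - l $ i)"
    using lu by (rule emeasure_box_cart)
  also have "\<dots> \<le> ennreal (1 / 2 ^ CARD('n))"
  proof (rule ennreal_leI)
    have B: "B = UNIV - A" using AB by auto
    have "(\<Sum>i\<in>UNIV. u $ i - l $ i) = (\<Sum>i\<in>A. u $ i - l $ i) + (\<Sum>i\<in>B. u $ i - l $ i)"
      using sum.union_disjoint [OF fin AB(2)] AB(1) by metis
    also have "\<dots> = (\<Sum>i\<in>A. Sup (S i)) + (\<Sum>i\<in>B. 1 - Inf (S i))"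
      by (simp add: l_def u_def B)
    also have "\<dots> \<le> real (card B)"
      using Sup_le_Inf by (simp add: sum_subtractf)
    \<comment> \<open>The balance \<open>card A = card B\<close> makes this half the dimension, so
      the mean side length is at most 1/2, the source of the base 2.\<close>
    also have "\<dots> = real CARD('n) / 2"
    proof -
      have "CARD('n) = 2 * card B"
        using card_Un_disjoint [OF fin AB(2)] AB(1,3) by simp
      then show ?thesis by simp
    qed
    finally have "(\<Sum>i\<in>UNIV. u $ i - l $ i) / CARD('n) \<le> 1 / 2"
      by (simp add: field_simps)
    moreover have "0 \<le> (\<Sum>i\<in>UNIV. u $ i - l $ i) / CARD('n)"
      using lu by (simp add: sum_nonneg)
    ultimately have "((\<Sum>i\<in>UNIV. u $ i - l $ i) / CARD('n)) ^ CARD('n) \<le> (1 / 2) ^ CARD('n)"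
      by (rule power_mono)
    moreover have "(\<Prod>i\<in>UNIV. u $ i - l $ i) \<le> ((\<Sum>i\<in>UNIV. u $ i - l $ i) / CARD('n)) ^ CARD('n)"
      using lu by (intro prod_le_mean_power) auto
    ultimately show "(\<Prod>i\<in>UNIV. u $ i - l $ i) \<le> 1 / 2 ^ CARD('n)"
      by (simp add: power_one_over)
  qed
  finally show ?thesis .
qed

section \<open>Entropy, and transfer from volume to the law of \<open>X\<close>\<close>

lemma shannon_entropy_ge:
  assumes p0: "\<And>i. i \<in> I \<Longrightarrow> 0 \<le> p i" and p: "\<And>i. i \<in> I \<Longrightarrow> p i \<le> 1 / 2 ^ n"
    and mass: "1 \<le> (\<Sum>\<^sub>\<infinity>i\<in>I. ennreal (p i))"
  shows "ennreal (real n) \<le> shannon_entropy I p"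
proof -
  have "ennreal (real n) \<le> ennreal (real n) * (\<Sum>\<^sub>\<infinity>i\<in>I. ennreal (p i))"
    using mult_left_mono [OF mass, of "ennreal (real n)"] by simp
  also have "\<dots> = (\<Sum>\<^sub>\<infinity>i\<in>I. ennreal (real n) * ennreal (p i))"
    by (simp add: nonneg_infsum_complete SUP_mult_left_ennreal sum_distrib_left)
  also have "\<dots> \<le> (\<Sum>\<^sub>\<infinity>i\<in>I. ennreal (p i * log 2 (1 / p i)))"
  proof (rule infsum_mono)
    fix i assume i: "i \<in> I"
    \<comment> \<open>The cell bound says \<open>log 2 (1 / p i)\<close> \<ge> \<open>n\<close> for
      positive \<open>p i\<close>; if \<open>p i = 0\<close>, the factor \<open>p i\<close> makes
      both sides 0.\<close>
    have "real n * p i \<le> p i * log 2 (1 / p i)"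
    proof (cases "p i = 0")
      case False
      then have pos: "p i > 0" using p0 [OF i] by simp
      have "2 ^ n \<le> 1 / p i"
        using p [OF i] pos by (simp add: field_simps)
      then have "real n \<le> log 2 (1 / p i)"
        using pos by (simp add: le_log_iff powr_realpow)
      then show ?thesis using pos by (simp add: mult.commute)
    qed simp
    then show "ennreal (real n) * ennreal (p i) \<le> ennreal (p i * log 2 (1 / p i))"
      using p0 [OF i] by (simp add: ennreal_leI flip: ennreal_mult)
  qed (simp_all add: nonneg_summable_on_complete)
  finally show ?thesis unfolding shannon_entropy_def .
qed

theorem mainTheorem4:
  fixes n m :: nat
    and a :: real
    and Hp Hm :: "'n::finite set"
    and f :: "real ^ 'n \<Rightarrow> nat"
    and M :: "'w measure"
    and X :: "'w \<Rightarrow> real ^ 'n"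
  assumes "n = CARD('n)" and "n > 2" and "even n"
    and "m = n div 2" and "a = 0"
    and "Hp \<union> Hm = UNIV" and "Hp \<inter> Hm = {}"
    and "card Hp = m" and "card Hm = m"
    and "f = halfspace_fun Hp Hm a"
    and "prob_space M" and "X \<in> borel_measurable M"
    and "distr M borel X = uniform_measure lborel unit_cube"
  shows "(\<forall>R. rectangle R \<and> R \<subseteq> level_set f 0 \<longrightarrow>
            measure M {\<omega> \<in> space M. X \<omega> \<in> R} \<le> 1 / 2 ^ n) \<and>
         (\<forall>P. zero_error_partition f P \<longrightarrow>
            shannon_entropy P (\<lambda>R. measure M {\<omega> \<in> space M. X \<omega> \<in> R}) \<ge> ennreal (real n))"
proof -
  interpret prob_space M by fact
  let ?p = "\<lambda>R. measure M {\<omega> \<in> space M. X \<omega> \<in> R}"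
  \<comment> \<open>A rectangle lies in the cube, and the cube has volume 1, so conditioning on the
    cube leaves its volume unchanged.\<close>
  have p_eq: "ennreal (?p R) = emeasure lborel R" if R: "rectangle R" for R
  proof -
    have Rb: "R \<in> sets borel" using R by (rule rectangle_measurable)
    have "{\<omega> \<in> space M. X \<omega> \<in> R} = X -` R \<inter> space M" by auto
    then have "ennreal (?p R) = emeasure (distr M borel X) R"
      using assms(12) Rb by (simp add: emeasure_distr emeasure_eq_measure)
    also have "\<dots> = emeasure lborel (unit_cube \<inter> R) / emeasure lborel (unit_cube :: (real ^ 'n) set)"
      unfolding assms(13) using Rb unit_cube_measurable by (intro emeasure_uniform_measure) auto
    also have "\<dots> = emeasure lborel R"
      using rectangle_subset_unit_cube [OF R] by (simp add: emeasure_unit_cube Int_absorb1 divide_ennreal_def)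
    finally show ?thesis .
  qed
  have p_le: "?p R \<le> 1 / 2 ^ n"
    if R: "rectangle R" and sub: "R \<subseteq> level_set f 0 \<or> R \<subseteq> level_set f 1" for R
  proof -
    have "emeasure lborel R \<le> ennreal (1 / 2 ^ CARD('n))"
      using sub
    proof
      assume "R \<subseteq> level_set f 0"
      then have "f x = 0" if "x \<in> R" for x
        using that by (auto simp: level_set_def)
      \<comment> \<open>Value 0 gives a strict inequality, weakened here to fit the volume bound;
        value 1 below gives the reverse weak inequality directly.\<close>
      then have "(\<Sum>i\<in>Hp. x $ i) \<le> (\<Sum>i\<in>Hm. x $ i)" if "x \<in> R" for x
        using that unfolding assms(5,10) halfspace_fun_def by (smt (verit) zero_neq_one)
      then show ?thesis
        using assms(6-9) by (intro emeasure_rectangle_le [OF R, of Hp Hm]) auto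
    next
      assume "R \<subseteq> level_set f 1"
      then have "f x = 1" if "x \<in> R" for x
        using that by (auto simp: level_set_def)
      then have "(\<Sum>i\<in>Hm. x $ i) \<le> (\<Sum>i\<in>Hp. x $ i)" if "x \<in> R" for x
        using that unfolding assms(5,10) halfspace_fun_def by (smt (verit) zero_neq_one)
      then show ?thesis
        using assms(6-9) by (intro emeasure_rectangle_le [OF R, of Hm Hp]) auto
    qed
    then show ?thesis
      by (simp add: assms(1) flip: p_eq [OF R])
  qed
  have "ennreal (real n) \<le> shannon_entropy P ?p" if P: "zero_error_partition f P" for P
  proof (rule shannon_entropy_ge)
    have cP: "countable P"
      and rP: "\<And>R. R \<in> P \<Longrightarrow> rectangle R"
      and lP: "\<And>R. R \<in> P \<Longrightarrow> R \<subseteq> level_set f 0 \<or> R \<subseteq> level_set f 1"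
      and cover: "AE x in lborel. x \<in> unit_cube \<longrightarrow> (\<exists>!R. R \<in> P \<and> x \<in> R)"
      using P unfolding zero_error_partition_def by auto
    show "?p R \<le> 1 / 2 ^ n" if "R \<in> P" for R
      using rP lP that p_le by blast
    have sP: "P \<subseteq> sets lborel"
      using rP rectangle_measurable by auto
    have "1 = emeasure lborel (unit_cube :: (real ^ 'n) set)"
      by (simp add: emeasure_unit_cube)
    \<comment> \<open>Almost every point of the cube lies in some cell, so \<Union>\<open>P\<close>
      has volume at least 1; subadditivity then passes this lower bound to the sum of the cell
      probabilities.\<close>
    also have "\<dots> \<le> emeasure lborel (\<Union>P)"
    proof (rule emeasure_mono_AE)
      show "AE x in lborel. x \<in> unit_cube \<longrightarrow> x \<in> \<Union>P"
        using cover by eventually_elim blast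
      show "\<Union>P \<in> sets lborel"
        using cP sP by (rule sets.countable_Union)
    qed
    also have "\<dots> \<le> (\<Sum>\<^sub>\<infinity>R\<in>P. emeasure lborel R)"
      using cP sP by (rule emeasure_Union_le_infsum)
    also have "\<dots> = (\<Sum>\<^sub>\<infinity>R\<in>P. ennreal (?p R))"
      using p_eq rP by (intro infsum_cong) simp
    finally show "1 \<le> (\<Sum>\<^sub>\<infinity>R\<in>P. ennreal (?p R))" .
  qed simp
  with p_le show ?thesis by blast
qed

end
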